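(* Let $N\in\mathbb{N}$ and let $F$ be an $\mathcal{F}_N$-measurable real random variable. Then $$\mathrm{Ent}[e^F]\le E\left[e^F\sum_{k=0}^Np_kq_k\left(\nabla_kF\,e^{\nabla_kF}-e^{\nabla_kF}+1\right)\right].$$
   Context: $\mathbb{N}=\{0,1,2,\ldots\}$. Let $(p_k)_{k\in\mathbb{N}}$ be a deterministic sequence in $(0,1)$ and $q_k=1-p_k$. Let $\Omega=\{-1,1\}^{\mathbb{N}}$ with its product $\sigma$-algebra, let $X_k:\Omega\to\{-1,1\}$ be the canonical projections, and let $\mathbb{P}$ be the product probability measure under which the $X_k$ are independent with $\mathbb{P}(X_k=1)=p_k$, $\mathbb{P}(X_k=-1)=q_k$. Set $\mathcal{F}_N=\sigma(X_0,\ldots,X_N)$. For $F=f(X_0,\ldots,X_N)$ and $0\le k\le N$, $$\nabla_kF=X_k\big(f(X_0,\ldots,X_{k-1},-1,X_{k+1},\ldots,X_N)-f(X_0,\ldots,X_{k-1},1,X_{k+1},\ldots,X_N)\big).$$ The entropy of a random variable $G>0$ is $\mathrm{Ent}[G]=E[G\log G]-E[G]\log E[G]$. *)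

theory Defs
  imports "HOL-Probability.Probability"
begin

definition sign_seqs :: "(nat \<Rightarrow> real) set"
  where "sign_seqs = (UNIV \<rightarrow>\<^sub>E {-1, 1})"

definition coord :: "nat \<Rightarrow> (nat \<Rightarrow> real) \<Rightarrow> real"
  where "coord k w = w k"

definition sign_law :: "real \<Rightarrow> real measure"
  where "sign_law r = point_measure {-1, 1} (\<lambda>x. ennreal (if x = 1 then r else 1 - r))"

definition sign_measure :: "(nat \<Rightarrow> real) \<Rightarrow> (nat \<Rightarrow> real) measure"
  where "sign_measure p = (\<Pi>\<^sub>M k\<in>UNIV. sign_law (p k))"

text \<open>The \<open>\<sigma>\<close>-algebra \<open>\<sigma>(X\<^sub>0, \<dots>, X\<^sub>N)\<close>; its measure component is the null measure, so it
  only carries measurability.\<close>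

definition sign_filtration :: "nat \<Rightarrow> (nat \<Rightarrow> real) measure"
  where "sign_filtration N =
    sigma sign_seqs {coord k -` A \<inter> sign_seqs | k A. k \<le> N \<and> A \<subseteq> {-1, 1}}"

text \<open>Since \<open>X\<^sub>k\<close> is the coordinate map \<open>coord k\<close>, replacing the \<open>k\<close>-th argument of \<open>f\<close> in
  \<open>F = f(X\<^sub>0, \<dots>, X\<^sub>N)\<close> amounts to updating \<open>w\<close> at \<open>k\<close>; this makes the gradient independent of
  the choice of \<open>f\<close> (see \<open>nabla_representation\<close>).\<close>

definition nabla :: "nat \<Rightarrow> ((nat \<Rightarrow> real) \<Rightarrow> real) \<Rightarrow> (nat \<Rightarrow> real) \<Rightarrow> real"
  where "nabla k F w = coord k w * (F (w(k := -1)) - F (w(k := 1)))"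

definition Ent :: "'a measure \<Rightarrow> ('a \<Rightarrow> real) \<Rightarrow> real"
  where "Ent M G =
    (\<integral>w. G w * ln (G w) \<partial>M) - (\<integral>w. G w \<partial>M) * ln (\<integral>w. G w \<partial>M)"

lemma space_sign_measure: "space (sign_measure p) = sign_seqs"
  by (simp add: sign_measure_def sign_law_def sign_seqs_def space_PiM space_point_measure)

lemma prob_space_sign_law:
  assumes "0 < r" "r < 1"
  shows "prob_space (sign_law r)"
proof
  have "ennreal r + ennreal (1 - r) = 1"
    using assms by (subst ennreal_plus[symmetric]) auto
  then show "emeasure (sign_law r) (space (sign_law r)) = 1"
    by (simp add: sign_law_def space_point_measure emeasure_point_measure_finite add.commute)
qed

lemma prob_space_sign_measure:
  assumes "\<And>k. 0 < p k \<and> p k < 1"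
  shows "prob_space (sign_measure p)"
  unfolding sign_measure_def
  by (intro prob_space_PiM prob_space_sign_law) (use assms in auto)

lemma prob_coord:
  assumes "\<And>k. 0 < p k \<and> p k < 1"
  shows "measure (sign_measure p) {w \<in> space (sign_measure p). coord k w = 1} = p k"
    and "measure (sign_measure p) {w \<in> space (sign_measure p). coord k w = -1} = 1 - p k"
proof -
  interpret product_prob_space "\<lambda>k. sign_law (p k)" UNIV
    by (rule product_prob_spaceI, rule prob_space_sign_law) (use assms in blast)+
  have "measure (sign_measure p) {w \<in> space (sign_measure p). coord k w = c}
      = measure (sign_law (p k)) {c}" if "c \<in> {-1, 1}" for c
  proof -
    have "measure (distr (sign_measure p) (sign_law (p k)) (\<lambda>w. w k)) {c}
        = measure (sign_measure p) ((\<lambda>w. w k) -` {c} \<inter> space (sign_measure p))"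
    proof (rule measure_distr)
      show "(\<lambda>w. w k) \<in> sign_measure p \<rightarrow>\<^sub>M sign_law (p k)"
        unfolding sign_measure_def by (rule measurable_component_singleton) simp
      show "{c} \<in> sets (sign_law (p k))"
        using that by (auto simp: sign_law_def sets_point_measure)
    qed
    also have "(\<lambda>w. w k) -` {c} \<inter> space (sign_measure p)
        = {w \<in> space (sign_measure p). coord k w = c}"
      by (auto simp: coord_def)
    finally show ?thesis
      using PiM_component[of k] by (simp add: sign_measure_def)
  qed
  then show "measure (sign_measure p) {w \<in> space (sign_measure p). coord k w = 1} = p k"
    and "measure (sign_measure p) {w \<in> space (sign_measure p). coord k w = -1} = 1 - p k"
    using assms[of k]
    by (auto simp: sign_law_def measure_def emeasure_point_measure_finite)
qed

lemma nabla_representation: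
  assumes F: "\<And>w. w \<in> sign_seqs \<Longrightarrow> F w = f (\<lambda>j\<in>{0..N}. coord j w)"
    and "k \<le> N" and "w \<in> sign_seqs"
  shows "nabla k F w = coord k w *
    (f ((\<lambda>j\<in>{0..N}. coord j w)(k := -1)) - f ((\<lambda>j\<in>{0..N}. coord j w)(k := 1)))"
proof -
  have "F (w(k := c)) = f ((\<lambda>j\<in>{0..N}. coord j w)(k := c))" if "c \<in> {-1, 1}" for c
  proof -
    have "w(k := c) \<in> sign_seqs"
      using assms(3) that by (auto simp: sign_seqs_def PiE_iff)
    moreover have "(\<lambda>j\<in>{0..N}. coord j (w(k := c))) = (\<lambda>j\<in>{0..N}. coord j w)(k := c)"
      using assms(2) by (auto simp: coord_def fun_eq_iff)
    ultimately show ?thesis using F by metis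
  qed
  then show ?thesis by (simp add: nabla_def)
qed

end

theory Submission
  imports Defs
begin

text \<open>Writing \<open>d(x, y) = y ln(y/x) - y + x\<close> and \<open>G = e\<^sup>F\<close>, the \<open>k\<close>-th term on the right-hand side
  is \<open>p\<^sub>k q\<^sub>k E[d(G, G \<circ> flip\<^sub>k)]\<close>. On a two-point space both sides of the inequality are functions of
  the probability \<open>p\<close>; the right-hand side is the cubic polynomial that agrees with the entropy to
  first order at \<open>0\<close> and \<open>1\<close>, so the Hermite interpolation error has the sign of a fourth
  derivative. The general case follows by averaging out one coordinate at a time: the entropy loses
  a conditional two-point entropy, and the remaining terms decrease because \<open>d\<close> is jointly convex.\<close>

section \<open>The two-point inequality\<close>

text \<open>This is the error formula for cubic Hermite interpolation at \<open>0\<close> and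
  \<open>1\<close>, for a function whose interpolant is zero:
  \<open>f r = r^2 * (1 - r)^2 * f4 z / 24\<close> for some \<open>z\<close> in the unit interval.
  Repeated use of Rolle's theorem produces \<open>z\<close>.\<close>

lemma cubic_hermite_nonneg:
  fixes f f1 f2 f3 f4 :: "real \<Rightarrow> real"
  assumes D1: "\<And>t. 0 \<le> t \<Longrightarrow> t \<le> 1 \<Longrightarrow> (f has_real_derivative f1 t) (at t)"
    and D2: "\<And>t. 0 \<le> t \<Longrightarrow> t \<le> 1 \<Longrightarrow> (f1 has_real_derivative f2 t) (at t)"
    and D3: "\<And>t. 0 \<le> t \<Longrightarrow> t \<le> 1 \<Longrightarrow> (f2 has_real_derivative f3 t) (at t)"
    and D4: "\<And>t. 0 \<le> t \<Longrightarrow> t \<le> 1 \<Longrightarrow> (f3 has_real_derivative f4 t) (at t)"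
    and zeros: "f 0 = 0" "f 1 = 0" "f1 0 = 0" "f1 1 = 0"
    and nonneg: "\<And>t. 0 \<le> t \<Longrightarrow> t \<le> 1 \<Longrightarrow> 0 \<le> f4 t"
    and r: "0 < r" "r < 1"
  shows "0 \<le> f r"
proof -
  have rolle: "\<exists>z. a < z \<and> z < b \<and> g' z = 0"
    if "0 \<le> a" "a < b" "b \<le> 1" "g a = 0" "g b = 0"
      and g: "\<And>t. 0 \<le> t \<Longrightarrow> t \<le> 1 \<Longrightarrow> (g has_real_derivative g' t) (at t)"
    for a b :: real and g g'
  proof -
    have "continuous_on {a..b} g"
      using g \<open>0 \<le> a\<close> \<open>b \<le> 1\<close>
      by (intro DERIV_continuous_on[of _ g g']) (auto intro: has_field_derivative_at_within)
    moreover have "g differentiable (at x)" if "a < x" "x < b" for x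
      using g[of x] that \<open>0 \<le> a\<close> \<open>b \<le> 1\<close> unfolding real_differentiable_def by force
    ultimately obtain z where z: "a < z" "z < b" "DERIV g z :> 0"
      using Rolle[of a b g] \<open>a < b\<close> \<open>g a = 0\<close> \<open>g b = 0\<close> by auto
    moreover have "g' z = 0"
      using DERIV_unique[OF z(3) g[of z]] z \<open>0 \<le> a\<close> \<open>b \<le> 1\<close> by simp
    ultimately show ?thesis by blast
  qed
  \<comment> \<open>The polynomial subtracted below is \<open>t^2 * (1 - t)^2\<close>, which has
    double zeros at \<open>0\<close> and \<open>1\<close>; \<open>c\<close> is chosen so that
    \<open>g\<close> vanishes at \<open>r\<close> as well.\<close>
  define c where "c = f r / (r^2 * (1 - r)^2)"
  define g where "g t = f t - c * (t^2 - 2 * t^3 + t^4)" for t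
  define g1 where "g1 t = f1 t - c * (2 * t - 6 * t^2 + 4 * t^3)" for t
  define g2 where "g2 t = f2 t - c * (2 - 12 * t + 12 * t^2)" for t
  define g3 where "g3 t = f3 t - c * (24 * t - 12)" for t
  define g4 where "g4 t = f4 t - c * 24" for t
  have d1: "(g has_real_derivative g1 t) (at t)" if "0 \<le> t" "t \<le> 1" for t
  proof -
    have "((\<lambda>t. c * (t^2 - 2 * t^3 + t^4)) has_real_derivative c * (2 * t - 6 * t^2 + 4 * t^3)) (at t)"
      by (auto intro!: derivative_eq_intros simp: algebra_simps)
    from DERIV_diff[OF D1[OF that] this] show ?thesis
      by (simp add: g_def[abs_def] g1_def)
  qed
  have d2: "(g1 has_real_derivative g2 t) (at t)" if "0 \<le> t" "t \<le> 1" for t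
  proof -
    have "((\<lambda>t. c * (2 * t - 6 * t^2 + 4 * t^3)) has_real_derivative c * (2 - 12 * t + 12 * t^2)) (at t)"
      by (auto intro!: derivative_eq_intros simp: algebra_simps)
    from DERIV_diff[OF D2[OF that] this] show ?thesis
      by (simp add: g1_def[abs_def] g2_def)
  qed
  have d3: "(g2 has_real_derivative g3 t) (at t)" if "0 \<le> t" "t \<le> 1" for t
  proof -
    have "((\<lambda>t. c * (2 - 12 * t + 12 * t^2)) has_real_derivative c * (24 * t - 12)) (at t)"
      by (auto intro!: derivative_eq_intros simp: algebra_simps)
    from DERIV_diff[OF D3[OF that] this] show ?thesis
      by (simp add: g2_def[abs_def] g3_def)
  qed
  have d4: "(g3 has_real_derivative g4 t) (at t)" if "0 \<le> t" "t \<le> 1" for t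
  proof -
    have "((\<lambda>t. c * (24 * t - 12)) has_real_derivative c * 24) (at t)"
      by (auto intro!: derivative_eq_intros simp: algebra_simps)
    from DERIV_diff[OF D4[OF that] this] show ?thesis
      by (simp add: g3_def[abs_def] g4_def)
  qed
  have poly: "r^2 - 2 * r^3 + r^4 = r^2 * (1 - r)^2"
    by algebra
  have "g 0 = 0" "g 1 = 0" "g1 0 = 0" "g1 1 = 0"
    using zeros by (auto simp: g_def g1_def)
  moreover have "g r = 0"
    using r by (simp add: g_def c_def poly)
  \<comment> \<open>Zero count: the zeros \<open>0\<close>, \<open>r\<close>, \<open>1\<close> of
    \<open>g\<close> give \<open>g1\<close> a zero on each side of \<open>r\<close>, besides its
    zeros at the endpoints. With four zeros of \<open>g1\<close>, there are three of
    \<open>g2\<close>, two of \<open>g3\<close> and one of \<open>g4\<close>.\<close>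
  ultimately obtain a b where ab: "0 < a" "a < r" "g1 a = 0" "r < b" "b < 1" "g1 b = 0"
    using rolle[of 0 r g g1, OF _ _ _ _ _ d1] rolle[of r 1 g g1, OF _ _ _ _ _ d1] r by auto
  obtain u where u: "0 < u" "u < a" "g2 u = 0"
    using rolle[of 0 a g1 g2, OF _ _ _ _ _ d2] ab r \<open>g1 0 = 0\<close> by auto
  obtain v where v: "a < v" "v < b" "g2 v = 0"
    using rolle[of a b g1 g2, OF _ _ _ _ _ d2] ab by auto
  obtain w where w: "b < w" "w < 1" "g2 w = 0"
    using rolle[of b 1 g1 g2, OF _ _ _ _ _ d2] ab r \<open>g1 1 = 0\<close> by auto
  obtain x where x: "u < x" "x < v" "g3 x = 0"
    using rolle[of u v g2 g3, OF _ _ _ _ _ d3] u v ab by auto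
  obtain y where y: "v < y" "y < w" "g3 y = 0"
    using rolle[of v w g2 g3, OF _ _ _ _ _ d3] u v w ab by auto
  obtain z where z: "x < z" "z < y" "g4 z = 0"
    using rolle[of x y g3 g4, OF _ _ _ _ _ d4] u v w x y ab by auto
  have "0 \<le> f4 z"
    using nonneg[of z] u v w x y z ab by auto
  then have "0 \<le> c"
    using z by (simp add: g4_def)
  then have "0 \<le> c * (r^2 * (1 - r)^2)"
    by simp
  then show ?thesis
    using r by (simp add: c_def)
qed

text \<open>The Bregman divergence of the convex function \<open>t * ln t\<close>, with base point
  \<open>x\<close>.\<close>

definition rel_div :: "real \<Rightarrow> real \<Rightarrow> real"
  where "rel_div x y = y * ln (y / x) - y + x"

text \<open>With \<open>x\<close> and \<open>y\<close> fixed, the weight \<open>r\<close> becomes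
  the variable \<open>t\<close>. A cubic has no fourth derivative, so only the term
  \<open>m t * ln (m t)\<close> contributes to it, with \<open>m\<close> affine and
  positive.\<close>

lemma two_point_entropy_le:
  fixes r x y :: real
  assumes r: "0 < r" "r < 1" and pos: "0 < x" "0 < y"
  shows "r * (x * ln x) + (1 - r) * (y * ln y)
      - (r * x + (1 - r) * y) * ln (r * x + (1 - r) * y)
    \<le> r * (1 - r) * (r * rel_div x y + (1 - r) * rel_div y x)"
proof -
  define m where "m t = t * x + (1 - t) * y" for t
  define A B where "A = rel_div x y" and "B = rel_div y x"
  have AB: "A = y * (ln y - ln x) - y + x" "B = x * (ln x - ln y) - x + y"
    using pos by (simp_all add: A_def B_def rel_div_def ln_div)
  have m_pos: "0 < m t" if "0 \<le> t" "t \<le> 1" for t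
  proof (cases "t = 0")
    case False
    then have "0 < t * x" "0 \<le> (1 - t) * y"
      using that pos by auto
    then show ?thesis by (simp add: m_def)
  qed (use pos in \<open>simp add: m_def\<close>)
  have dm: "(m has_real_derivative x - y) (at t)" for t
    unfolding m_def by (auto intro!: derivative_eq_intros)
  \<comment> \<open>The right-hand side minus the left-hand side at weight \<open>t\<close>, the
    cubic being expanded in powers of \<open>t\<close>. The values of \<open>A\<close> and
    \<open>B\<close> are exactly those that make \<open>f1\<close> vanish at \<open>1\<close> and at
    \<open>0\<close>.\<close>
  define f where "f t = m t * ln (m t) - t * (x * ln x) - (1 - t) * (y * ln y)
      + B * t + (A - 2 * B) * t^2 - (A - B) * t^3" for t
  define f1 where "f1 t = (x - y) * (ln (m t) + 1) - x * ln x + y * ln y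
      + B + 2 * (A - 2 * B) * t - 3 * (A - B) * t^2" for t
  define f2 where "f2 t = (x - y)^2 / m t + 2 * (A - 2 * B) - 6 * (A - B) * t" for t
  define f3 where "f3 t = - ((x - y)^3 / (m t)^2) - 6 * (A - B)" for t
  define f4 where "f4 t = 2 * (x - y)^4 / (m t)^3" for t
  have "0 \<le> f r"
  proof (rule cubic_hermite_nonneg[of f f1 f2 f3 f4])
    fix t :: real assume t: "0 \<le> t" "t \<le> 1"
    note mt = m_pos[OF t]
    show "(f has_real_derivative f1 t) (at t)"
      unfolding f_def f1_def using mt
      by (auto intro!: derivative_eq_intros dm simp: field_simps power2_eq_square)
    show "(f1 has_real_derivative f2 t) (at t)"
      unfolding f1_def f2_def using mt
      by (auto intro!: derivative_eq_intros dm simp: field_simps power2_eq_square)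
    show "(f2 has_real_derivative f3 t) (at t)"
      unfolding f2_def f3_def using mt
      by (auto intro!: derivative_eq_intros dm simp: field_simps power2_eq_square power3_eq_cube)
    show "(f3 has_real_derivative f4 t) (at t)"
      unfolding f3_def f4_def using mt
      by (auto intro!: derivative_eq_intros dm
          simp: field_simps power2_eq_square power3_eq_cube power4_eq_xxxx)
    show "0 \<le> f4 t"
      unfolding f4_def using mt by simp
  qed (use r in \<open>auto simp: f_def f1_def m_def AB algebra_simps\<close>)
  moreover have "B * r + (A - 2 * B) * r^2 - (A - B) * r^3 = r * (1 - r) * (r * A + (1 - r) * B)"
    by algebra
  ultimately show ?thesis
    by (simp add: f_def m_def A_def B_def)
qed

text \<open>Each \<open>rel_div\<close> is bounded below by its tangent at the averaged point, which is
  \<open>ln z \<le> z - 1\<close>.\<close>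

lemma rel_div_convex:
  fixes r x y x' y' :: real
  assumes r: "0 < r" "r < 1" and pos: "0 < x" "0 < y" "0 < x'" "0 < y'"
  shows "rel_div (r * x + (1 - r) * x') (r * y + (1 - r) * y')
    \<le> r * rel_div x y + (1 - r) * rel_div x' y'"
proof -
  define X Y where "X = r * x + (1 - r) * x'" and "Y = r * y + (1 - r) * y'"
  have XY: "0 < X" "0 < Y"
    using assms by (auto simp: X_def Y_def intro!: add_pos_pos mult_pos_pos)
  have tangent: "v * ln (Y / X) + v - u * (Y / X) \<le> v * ln (v / u)" if "0 < u" "0 < v" for u v
  proof -
    have "ln ((u * Y) / (v * X)) \<le> (u * Y) / (v * X) - 1"
      using that XY by (intro ln_le_minus_one) auto
    then have "v * ln ((u * Y) / (v * X)) \<le> v * ((u * Y) / (v * X) - 1)"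
      using that by (intro mult_left_mono) auto
    moreover have "ln ((u * Y) / (v * X)) = ln (Y / X) - ln (v / u)"
      using that XY by (simp add: ln_div ln_mult)
    moreover have "v * ((u * Y) / (v * X) - 1) = u * (Y / X) - v"
      using that XY by (simp add: field_simps)
    ultimately have "v * (ln (Y / X) - ln (v / u)) \<le> u * (Y / X) - v"
      by metis
    then show ?thesis by (simp add: right_diff_distrib)
  qed
  define l q where "l = ln (Y / X)" and "q = Y / X"
  have "X * q = Y"
    using XY by (simp add: q_def)
  have "r * (y * l + y - x * q) + (1 - r) * (y' * l + y' - x' * q)
      \<le> r * (y * ln (y / x)) + (1 - r) * (y' * ln (y' / x'))"
    using tangent[of x y] tangent[of x' y'] assms
    by (intro add_mono mult_left_mono) (auto simp: l_def q_def)
  \<comment> \<open>Both tangent bounds have the same coefficients \<open>l\<close> and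
    \<open>q\<close>, so their weighted sum is the tangent expression at \<open>X\<close>,
    \<open>Y\<close>, where \<open>Y - X * q\<close> cancels.\<close>
  also have "r * (y * l + y - x * q) + (1 - r) * (y' * l + y' - x' * q) = Y * l + Y - X * q"
    by (simp add: X_def Y_def algebra_simps)
  finally have "Y * l \<le> r * (y * ln (y / x)) + (1 - r) * (y' * ln (y' / x'))"
    using \<open>X * q = Y\<close> by simp
  then have "rel_div X Y \<le> r * (y * ln (y / x)) + (1 - r) * (y' * ln (y' / x')) - Y + X"
    by (simp add: rel_div_def l_def)
  also have "\<dots> = r * rel_div x y + (1 - r) * rel_div x' y'"
    by (simp add: rel_div_def X_def Y_def algebra_simps)
  finally show ?thesis
    by (simp add: X_def Y_def)
qed

section \<open>Functions of finitely many signs\<close>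

text \<open>The bound is strict, so measurability for \<open>sign_filtration N\<close> yields
  \<open>depends_below (Suc N)\<close>. Only sign sequences are compared, since values of
  \<open>G\<close> elsewhere are arbitrary.\<close>

definition depends_below :: "nat \<Rightarrow> ((nat \<Rightarrow> real) \<Rightarrow> real) \<Rightarrow> bool"
  where "depends_below n G \<longleftrightarrow>
    (\<forall>w\<in>sign_seqs. \<forall>w'\<in>sign_seqs. (\<forall>k<n. w k = w' k) \<longrightarrow> G w = G w')"

definition flip :: "nat \<Rightarrow> (nat \<Rightarrow> real) \<Rightarrow> (nat \<Rightarrow> real)"
  where "flip k w = w(k := - w k)"

text \<open>A pointwise version of the conditional expectation of \<open>G\<close> given all
  coordinates except the \<open>k\<close>-th.\<close>

definition coord_avg :: "(nat \<Rightarrow> real) \<Rightarrow> nat \<Rightarrow> ((nat \<Rightarrow> real) \<Rightarrow> real) \<Rightarrow> (nat \<Rightarrow> real) \<Rightarrow> real"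
  where "coord_avg p k G w = p k * G (w(k := 1)) + (1 - p k) * G (w(k := -1))"

lemma sign_seqs_iff: "w \<in> sign_seqs \<longleftrightarrow> (\<forall>k. w k = -1 \<or> w k = 1)"
  by (auto simp: sign_seqs_def PiE_iff)

lemma upd_sign_seqs: "w \<in> sign_seqs \<Longrightarrow> c \<in> {-1, 1} \<Longrightarrow> w(k := c) \<in> sign_seqs"
  by (auto simp: sign_seqs_iff)

lemma flip_sign_seqs: "w \<in> sign_seqs \<Longrightarrow> flip k w \<in> sign_seqs"
  unfolding flip_def by (auto simp: sign_seqs_iff)

lemma depends_belowD:
  "depends_below n G \<Longrightarrow> w \<in> sign_seqs \<Longrightarrow> w' \<in> sign_seqs \<Longrightarrow> (\<And>k. k < n \<Longrightarrow> w k = w' k)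
    \<Longrightarrow> G w = G w'"
  unfolding depends_below_def by blast

lemma depends_below_comp:
  "depends_below n G \<Longrightarrow> depends_below n (\<lambda>w. h (G w))"
  unfolding depends_below_def by metis

lemma depends_below_comp2:
  "depends_below n G \<Longrightarrow> depends_below n H \<Longrightarrow> depends_below n (\<lambda>w. h (G w) (H w))"
  unfolding depends_below_def by metis

lemma depends_below_flip:
  assumes "depends_below n G"
  shows "depends_below n (\<lambda>w. G (flip k w))"
  unfolding depends_below_def
proof (intro ballI impI)
  fix w w' assume "w \<in> sign_seqs" "w' \<in> sign_seqs" "\<forall>j<n. w j = w' j"
  then show "G (flip k w) = G (flip k w')"
    by (intro depends_belowD[OF assms] flip_sign_seqs) (auto simp: flip_def)
qed

lemma depends_below_upd:
  assumes "depends_below (Suc n) G" "c \<in> {-1, 1}"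
  shows "depends_below n (\<lambda>w. G (w(n := c)))"
  unfolding depends_below_def
proof (intro ballI impI)
  fix w w' assume "w \<in> sign_seqs" "w' \<in> sign_seqs" "\<forall>j<n. w j = w' j"
  then show "G (w(n := c)) = G (w'(n := c))"
    using assms(2) by (intro depends_belowD[OF assms(1)] upd_sign_seqs) auto
qed

lemma depends_below_coord_avg:
  "depends_below (Suc n) G \<Longrightarrow> depends_below n (coord_avg p n G)"
  unfolding coord_avg_def
  by (intro depends_below_comp2[where h = "\<lambda>a b. p n * a + (1 - p n) * b"] depends_below_upd) auto

text \<open>The sets that do not separate \<open>w\<close> from \<open>w'\<close> are closed under
  complements and countable unions and include the generators; the level set of \<open>F\<close>
  through \<open>w\<close> is therefore one of them.\<close>

lemma depends_below_sign_filtration: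
  assumes "F \<in> borel_measurable (sign_filtration N)"
  shows "depends_below (Suc N) F"
  unfolding depends_below_def
proof (intro ballI impI)
  fix w w' assume w: "w \<in> sign_seqs" "w' \<in> sign_seqs" "\<forall>k<Suc N. w k = w' k"
  let ?gen = "{coord k -` A \<inter> sign_seqs | k A. k \<le> N \<and> A \<subseteq> {-1, 1 :: real}}"
  have gen: "?gen \<subseteq> Pow sign_seqs"
    by auto
  have saturated: "w \<in> S \<longleftrightarrow> w' \<in> S" if "S \<in> sigma_sets sign_seqs ?gen" for S
    using that
  proof induction
    case (Basic S)
    then show ?case
      using w by (auto simp: coord_def)
  qed (use w in auto)
  have "F -` {F w} \<inter> space (sign_filtration N) \<in> sets (sign_filtration N)"
    using assms by (rule measurable_sets) simp
  then have "F -` {F w} \<inter> sign_seqs \<in> sigma_sets sign_seqs ?gen"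
    using gen by (simp add: sign_filtration_def)
  from saturated[OF this] show "F w = F w'"
    using w by auto
qed

section \<open>Averaging out one coordinate\<close>

text \<open>Fubini after splitting off factor \<open>n\<close>. Points of the remaining product are
  \<open>undefined\<close> at \<open>n\<close>, which is harmless because
  \<open>coord_avg p n G\<close> overwrites that coordinate.\<close>

lemma integral_sign_measure_coord:
  assumes p: "\<And>k. 0 < p k \<and> p k < 1" and G: "integrable (sign_measure p) G"
  shows "(\<integral>w. G w \<partial>sign_measure p)
    = (\<integral>w. coord_avg p n G w \<partial>(\<Pi>\<^sub>M k\<in>UNIV - {n}. sign_law (p k)))"
proof -
  let ?P = "\<Pi>\<^sub>M k\<in>UNIV - {n}. sign_law (p k)"
  let ?h = "\<lambda>(x, X). X(n := x)"
  have prob: "prob_space (sign_law (p k))" for k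
    using p by (intro prob_space_sign_law) auto
  interpret L: prob_space "sign_law (p n)" by (rule prob)
  interpret P: prob_space ?P by (intro prob_space_PiM prob)
  interpret pair_sigma_finite "sign_law (p n)" ?P ..
  have ins: "insert n (UNIV - {n}) = UNIV"
    by auto
  have distr: "sign_measure p = distr (sign_law (p n) \<Otimes>\<^sub>M ?P) (sign_measure p) ?h"
    using distr_pair_PiM_eq_PiM[of "UNIV - {n}" "\<lambda>k. sign_law (p k)" n] prob
    by (simp add: sign_measure_def ins)
  have h: "?h \<in> sign_law (p n) \<Otimes>\<^sub>M ?P \<rightarrow>\<^sub>M sign_measure p"
    unfolding sign_measure_def split_beta'
    by (rule measurable_fun_upd[where J = "UNIV - {n}"]) auto
  have G_meas: "G \<in> borel_measurable (sign_measure p)"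
    using G by simp
  have int: "integrable (sign_law (p n) \<Otimes>\<^sub>M ?P) (\<lambda>(x, X). G (X(n := x)))"
  proof -
    have "integrable (distr (sign_law (p n) \<Otimes>\<^sub>M ?P) (sign_measure p) ?h) G"
      using G distr by metis
    from integrable_distr[OF h this] show ?thesis
      by (simp add: split_beta')
  qed
  have "(\<integral>w. G w \<partial>sign_measure p)
      = (\<integral>z. G (?h z) \<partial>(sign_law (p n) \<Otimes>\<^sub>M ?P))"
    using integral_distr[OF h G_meas] distr by metis
  also have "\<dots> = (\<integral>X. (\<integral>x. G (X(n := x)) \<partial>sign_law (p n)) \<partial>?P)"
    using integral_snd[OF int] by (simp add: split_beta')
  also have "\<dots> = (\<integral>X. coord_avg p n G X \<partial>?P)"
    using p[of n]
    by (simp add: sign_law_def lebesgue_integral_point_measure_finite coord_avg_def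
        add.commute)
  finally show ?thesis .
qed

text \<open>Averaging over a coordinate is idempotent, so both integrals reduce to the same one over
  the other coordinates.\<close>

lemma integral_coord_avg:
  assumes p: "\<And>k. 0 < p k \<and> p k < 1" and "integrable (sign_measure p) G"
    and "integrable (sign_measure p) (coord_avg p n G)"
  shows "(\<integral>w. coord_avg p n G w \<partial>sign_measure p) = (\<integral>w. G w \<partial>sign_measure p)"
proof -
  have "coord_avg p n (coord_avg p n G) = coord_avg p n G"
    by (auto simp: coord_avg_def fun_eq_iff algebra_simps)
  then show ?thesis
    using integral_sign_measure_coord[OF p assms(2), of n]
      integral_sign_measure_coord[OF p assms(3), of n]
    by simp
qed

text \<open>Splitting by the last relevant sign writes \<open>G\<close> as a sum of two functions of
  fewer signs, each times a measurable indicator; the induction thus delivers measurability and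
  integrability together.\<close>

lemma integrable_depends_below:
  assumes p: "\<And>k. 0 < p k \<and> p k < 1" and "depends_below n G"
  shows "integrable (sign_measure p) G"
  using assms(2)
proof (induction n arbitrary: G)
  case 0
  interpret prob_space "sign_measure p" by (rule prob_space_sign_measure[OF p])
  have one: "(\<lambda>_. 1) \<in> sign_seqs"
    by (simp add: sign_seqs_iff)
  have "G w = G (\<lambda>_. 1)" if "w \<in> sign_seqs" for w
    using depends_belowD[OF 0 that one] by simp
  then have "integrable (sign_measure p) G \<longleftrightarrow> integrable (sign_measure p) (\<lambda>_. G (\<lambda>_. 1))"
    by (intro Bochner_Integration.integrable_cong) (auto simp: space_sign_measure)
  then show ?case by simp
next
  case (Suc n)
  define A where "A c = {w \<in> space (sign_measure p). w n = c}" for c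
  have A: "A c \<in> sets (sign_measure p)" if "c \<in> {-1, 1}" for c
  proof -
    have "(\<lambda>w. w n) \<in> sign_measure p \<rightarrow>\<^sub>M sign_law (p n)"
      unfolding sign_measure_def by (rule measurable_component_singleton) simp
    moreover have "{c} \<in> sets (sign_law (p n))"
      using that by (auto simp: sign_law_def sets_point_measure)
    ultimately have "(\<lambda>w. w n) -` {c} \<inter> space (sign_measure p) \<in> sets (sign_measure p)"
      by (rule measurable_sets)
    also have "(\<lambda>w. w n) -` {c} \<inter> space (sign_measure p) = A c"
      by (auto simp: A_def)
    finally show ?thesis .
  qed
  have "integrable (sign_measure p) (\<lambda>w. G (w(n := 1)) * indicator (A 1) w
      + G (w(n := -1)) * indicator (A (-1)) w)"
    using Suc by (intro Bochner_Integration.integrable_add integrable_real_mult_indicator A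
        Suc.IH depends_below_upd) auto
  moreover have "G w = G (w(n := 1)) * indicator (A 1) w + G (w(n := -1)) * indicator (A (-1)) w"
    if "w \<in> space (sign_measure p)" for w
  proof -
    have "w \<in> sign_seqs"
      using that by (simp add: space_sign_measure)
    then consider "w n = 1" | "w n = -1"
      by (auto simp: sign_seqs_iff)
    then show ?thesis
      using that by cases (simp_all add: A_def fun_upd_idem)
  qed
  ultimately show ?case
    by (subst Bochner_Integration.integrable_cong[OF refl]) auto
qed

section \<open>The modified logarithmic Sobolev inequality\<close>

lemma Ent_le_sum_rel_div:
  assumes p: "\<And>k. 0 < p k \<and> p k < 1"
    and "depends_below n G" and "\<And>w. w \<in> sign_seqs \<Longrightarrow> 0 < G w"
  shows "Ent (sign_measure p) G
    \<le> (\<Sum>k<n. p k * (1 - p k) * (\<integral>w. rel_div (G w) (G (flip k w)) \<partial>sign_measure p))"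
  using assms(2,3)
proof (induction n arbitrary: G)
  case 0
  interpret prob_space "sign_measure p" by (rule prob_space_sign_measure[OF p])
  have one: "(\<lambda>_. 1) \<in> sign_seqs"
    by (simp add: sign_seqs_iff)
  have const: "G w = G (\<lambda>_. 1)" if "w \<in> sign_seqs" for w
    using depends_belowD[OF 0(1) that one] by simp
  have "(\<integral>w. G w * ln (G w) \<partial>sign_measure p)
      = (\<integral>w. G (\<lambda>_. 1) * ln (G (\<lambda>_. 1)) \<partial>sign_measure p)"
    using const by (intro Bochner_Integration.integral_cong) (simp_all add: space_sign_measure)
  moreover have "(\<integral>w. G w \<partial>sign_measure p) = (\<integral>w. G (\<lambda>_. 1) \<partial>sign_measure p)"
    using const by (intro Bochner_Integration.integral_cong) (simp_all add: space_sign_measure)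
  ultimately show ?case
    by (simp add: Ent_def prob_space)
next
  case (Suc n)
  let ?M = "sign_measure p"
  let ?R = "\<lambda>k G w. rel_div (G w) (G (flip k w))"
  define H where "H = coord_avg p n G"
  have H_dep: "depends_below n H"
    unfolding H_def by (rule depends_below_coord_avg[OF Suc.prems(1)])
  have H_pos: "0 < H w" if "w \<in> sign_seqs" for w
    using p[of n] that Suc.prems(2) upd_sign_seqs[OF that]
    by (auto simp: H_def coord_avg_def intro!: add_pos_pos mult_pos_pos)
  have int: "integrable ?M K" "integrable ?M (coord_avg p n K)"
    "(\<integral>w. coord_avg p n K w \<partial>?M) = (\<integral>w. K w \<partial>?M)"
    if "depends_below (Suc n) K" for K
    using integrable_depends_below[OF p that]
      integrable_depends_below[OF p depends_below_coord_avg[OF that]]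
      integral_coord_avg[OF p] by auto
  have R_dep: "depends_below m (?R k K)" if "depends_below m K" for m k K
    by (rule depends_below_comp2[OF that depends_below_flip[OF that]])
  have GlnG_dep: "depends_below (Suc n) (\<lambda>w. G w * ln (G w))"
    by (rule depends_below_comp[OF Suc.prems(1)])
  have HlnH_int: "integrable ?M (\<lambda>w. H w * ln (H w))"
    by (rule integrable_depends_below[OF p depends_below_comp[OF H_dep]])

  \<comment> \<open>\<open>G\<close> and \<open>H\<close> have the same mean, so the terms with the
    logarithm of the mean cancel; what remains is the mean of the conditional two-point entropy of
    \<open>G\<close> in coordinate \<open>n\<close>.\<close>
  have "Ent ?M G - Ent ?M H = (\<integral>w. G w * ln (G w) \<partial>?M) - (\<integral>w. H w * ln (H w) \<partial>?M)"
    using int(3)[OF Suc.prems(1)] by (simp add: Ent_def H_def)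
  also have "\<dots> = (\<integral>w. coord_avg p n (\<lambda>w. G w * ln (G w)) w - H w * ln (H w) \<partial>?M)"
    using int[OF GlnG_dep] HlnH_int by simp
  also have "\<dots> \<le> (\<integral>w. p n * (1 - p n) * coord_avg p n (?R n G) w \<partial>?M)"
  proof (rule integral_mono)
    fix w assume "w \<in> space ?M"
    then have w: "w \<in> sign_seqs"
      by (simp add: space_sign_measure)
    show "coord_avg p n (\<lambda>w. G w * ln (G w)) w - H w * ln (H w)
        \<le> p n * (1 - p n) * coord_avg p n (?R n G) w"
      using two_point_entropy_le[of "p n" "G (w(n := 1))" "G (w(n := -1))"] p[of n]
        Suc.prems(2)[OF upd_sign_seqs[OF w]]
      by (simp add: coord_avg_def H_def flip_def)
  qed (use int[OF GlnG_dep] int[OF R_dep[OF Suc.prems(1)]] HlnH_int in auto)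
  also have "\<dots> = p n * (1 - p n) * (\<integral>w. ?R n G w \<partial>?M)"
    using int(3)[OF R_dep[OF Suc.prems(1)]] by simp
  finally have step: "Ent ?M G - Ent ?M H \<le> p n * (1 - p n) * (\<integral>w. ?R n G w \<partial>?M)" .

  \<comment> \<open>For \<open>k < n\<close> the flip at \<open>k\<close> commutes with fixing
    coordinate \<open>n\<close>, so \<open>H\<close> at \<open>w\<close> and at
    \<open>flip k w\<close> averages matching pairs of values of \<open>G\<close>, and joint
    convexity applies pointwise.\<close>
  have "(\<integral>w. ?R k H w \<partial>?M) \<le> (\<integral>w. ?R k G w \<partial>?M)" if "k < n" for k
  proof -
    have "(\<integral>w. ?R k H w \<partial>?M) \<le> (\<integral>w. coord_avg p n (?R k G) w \<partial>?M)"
    proof (rule integral_mono)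
      fix w assume "w \<in> space ?M"
      then have w: "w \<in> sign_seqs"
        by (simp add: space_sign_measure)
      have comm: "(flip k w)(n := c) = flip k (w(n := c))" for c
        using that by (auto simp: flip_def fun_eq_iff)
      show "?R k H w \<le> coord_avg p n (?R k G) w"
        using p[of n] w unfolding H_def coord_avg_def comm
        by (intro rel_div_convex Suc.prems(2) upd_sign_seqs flip_sign_seqs) auto
    qed (use int[OF R_dep[OF Suc.prems(1)]]
        integrable_depends_below[OF p R_dep[OF H_dep]] in auto)
    then show ?thesis
      using int(3)[OF R_dep[OF Suc.prems(1)]] by simp
  qed
  then have "(\<Sum>k<n. p k * (1 - p k) * (\<integral>w. ?R k H w \<partial>?M))
      \<le> (\<Sum>k<n. p k * (1 - p k) * (\<integral>w. ?R k G w \<partial>?M))"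
    using p by (intro sum_mono mult_left_mono) (auto simp: less_imp_le)
  with Suc.IH[OF H_dep H_pos] step show ?case
    by simp
qed

text \<open>The factor \<open>coord k w\<close> orients the difference in \<open>nabla\<close> so
  that, for either sign, it is the increment of \<open>F\<close> under the flip; the ratio of the
  two exponentials is then \<open>exp (nabla k F w)\<close>.\<close>

lemma rel_div_exp_flip:
  assumes "w \<in> sign_seqs"
  shows "rel_div (exp (F w)) (exp (F (flip k w)))
    = exp (F w) * (nabla k F w * exp (nabla k F w) - exp (nabla k F w) + 1)"
proof -
  have "w k = 1 \<or> w k = -1"
    using assms by (auto simp: sign_seqs_iff)
  then have "nabla k F w = F (flip k w) - F w"
    by (auto simp: nabla_def coord_def flip_def fun_upd_idem)
  then have "F (flip k w) = F w + nabla k F w"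
    by simp
  then show ?thesis
    by (simp add: rel_div_def exp_add algebra_simps)
qed

theorem theorem13p10:
  fixes p :: "nat \<Rightarrow> real" and N :: nat and F :: "(nat \<Rightarrow> real) \<Rightarrow> real"
  assumes "\<And>k. 0 < p k \<and> p k < 1"
    and "F \<in> borel_measurable (sign_filtration N)"
  shows "Ent (sign_measure p) (\<lambda>w. exp (F w)) \<le>
    (\<integral>w. exp (F w) * (\<Sum>k=0..N. p k * (1 - p k) *
      (nabla k F w * exp (nabla k F w) - exp (nabla k F w) + 1)) \<partial>(sign_measure p))"
proof -
  let ?R = "\<lambda>k w. rel_div (exp (F w)) (exp (F (flip k w)))"
  have F: "depends_below (Suc N) (\<lambda>w. exp (F w))"
    by (rule depends_below_comp[OF depends_below_sign_filtration[OF assms(2)]])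
  have R: "integrable (sign_measure p) (?R k)" for k
    by (rule integrable_depends_below[OF assms(1)
          depends_below_comp2[OF F depends_below_flip[OF F]]])
  have "Ent (sign_measure p) (\<lambda>w. exp (F w))
      \<le> (\<Sum>k<Suc N. p k * (1 - p k) * (\<integral>w. ?R k w \<partial>sign_measure p))"
    by (rule Ent_le_sum_rel_div[OF assms(1) F]) simp_all
  also have "\<dots> = (\<integral>w. (\<Sum>k<Suc N. p k * (1 - p k) * ?R k w) \<partial>sign_measure p)"
    using R by (simp del: sum.lessThan_Suc)
  also have "\<dots> = (\<integral>w. exp (F w) * (\<Sum>k=0..N. p k * (1 - p k) *
      (nabla k F w * exp (nabla k F w) - exp (nabla k F w) + 1)) \<partial>(sign_measure p))"
    by (intro Bochner_Integration.integral_cong)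
      (simp_all add: space_sign_measure rel_div_exp_flip sum_distrib_left lessThan_Suc_atMost
        atLeast0AtMost mult.left_commute del: sum.lessThan_Suc)
  finally show ?thesis .
qed

end
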